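(* Let $f:\mathbb{R}^n\to\mathbb{R}$ be convex and locally Lipschitz continuous, let $\lambda>0$, let $F$ be the Moreau-Yosida regularization of $f$ with parameter $\lambda$, and let $\{x_k\}_{k\ge0}$, $\{d_k\}$, $\{\varepsilon_k\}$ be infinite sequences generated by Algorithm W (described in the context) with parameters $\lambda,\delta,\sigma,\eta,\tau,\varepsilon_0,\rho_0$. Put $$m_0=\frac{\lambda(1-\sigma)\eta}{(\tau+1/4)^2},\qquad m=\frac{m_0}{2}.$$ Assume: (1) $f$, and hence $F$, is bounded below on $\mathbb{R}^n$; (2) $\varepsilon_k\downarrow0$ and $\varepsilon_k=o(\|d_k\|^2)$ as $k\to\infty$; (3) there is a constant $\gamma$ with $0<\gamma\le\frac{m_0^2}{32\lambda}$ such that $\varepsilon_k\le\gamma\|d_k\|^2$ for all $k\ge0$; (4) $f$ is $\mu$-strongly convex for some $\mu>0$, i.e. $f(y)\ge f(x)+\xi^\top(y-x)+\frac{\mu}{2}\|y-x\|^2$ for all $x,y\in\mathbb{R}^n$ and all $\xi\in\partial f(x)$. Let $\nu=\frac{\mu}{1+\lambda\mu}$. Suppose the algorithm parameters are such that $$\rho:=1-\delta m\eta\nu\in(0,1),$$ and suppose further that, for some fixed $q\in(0,\rho)$, $$\varepsilon_k\le\varepsilon_0q^k\quad\text{for all }k\ge0.$$ Then $F$ has a unique minimizer $x^\star$ and, with $F^\star=F(x^\star)$, the iterates satisfy $$F(x_k)-F^\star\le K\rho^k,\qquad \|x_k-x^\star\|\le\sqrt{\frac{2K}{\nu}}\,\rho^{k/2},\qquad\text{for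 all }k\ge0,$$ where $K=(F(x_0)-F^\star)+\frac{C}{\rho-q}$ and $C=\left(1+\frac{2\delta m\eta}{\lambda}\right)\varepsilon_0$. In particular, $\{x_k\}$ converges to $x^\star$ R-linearly.
   Context: $\|\cdot\|$ is the Euclidean norm on $\mathbb{R}^n$; $\partial f$ is the convex subdifferential. Moreau-Yosida regularization: $F(x)=\min_{z\in\mathbb{R}^n}\{f(z)+\frac{1}{2\lambda}\|z-x\|^2\}$, $p(x)=\arg\min_{z\in\mathbb{R}^n}\{f(z)+\frac1{2\lambda}\|z-x\|^2\}$. $F$ is finite, convex and differentiable, with gradient $\nabla F(x)=(x-p(x))/\lambda$. Inexact quantities: for each $x\in\mathbb{R}^n$ and $\varepsilon>0$, $p^a(x,\varepsilon)$ denotes a chosen point satisfying $f(p^a(x,\varepsilon))+\frac1{2\lambda}\|p^a(x,\varepsilon)-x\|^2\le F(x)+\varepsilon$. Set $F^a(x,\varepsilon)=f(p^a(x,\varepsilon))+\frac{1}{2\lambda}\|p^a(x,\varepsilon)-x\|^2$ and $g^a(x,\varepsilon)=(x-p^a(x,\varepsilon))/\lambda$. Algorithm W. Parameters: $x_0\in\mathbb{R}^n$, $\lambda>0$, $0<\delta\le\sigma<1$, $0<\eta<\frac34$, $\tau>\frac14+\eta$, $\varepsilon_0\in(0,1)$, safeguard $\rho_0>0$. Set $\tilde g_0=g^a(x_0,\varepsilon_0)$, $d_0=-\tilde g_0$, $\theta_0=1$. For $k=0,1,2,\dots$: Step 1. If $\tilde g_k=0$, stop. Step 2. Choose $\varepsilon_{k+1}\in(0,\varepsilon_k)$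 and a step length $\alpha_k>0$ such that, with $x_{k+1}=x_k+\alpha_kd_k$ and $\tilde g_{k+1}=g^a(x_{k+1},\varepsilon_{k+1})$, the Wolfe-type conditions hold: $$F^a(x_k+\alpha_kd_k,\varepsilon_{k+1})-F^a(x_k,\varepsilon_k)\le\delta\alpha_k\tilde g_k^\top d_k,\qquad \tilde g_{k+1}^\top d_k\ge\sigma\tilde g_k^\top d_k.$$ Step 3. Set $y_k=\tilde g_{k+1}-\tilde g_k$. Step 4. If $|d_k^\top y_k|<\rho_0$, set $\beta_k=0$, $\theta_{k+1}=1$. Otherwise let $$\hat\beta_k=\frac{\tilde g_{k+1}^\top y_k}{d_k^\top y_k}-\|y_k\|^2\frac{d_k^\top\tilde g_{k+1}}{(d_k^\top y_k)^2},\qquad \theta^{QN}_{k+1}=1-\|y_k\|^2\frac{d_k^\top\tilde g_{k+1}}{(d_k^\top y_k)(y_k^\top\tilde g_{k+1})};$$ set $\beta_k=\hat\beta_k$ if $|\hat\beta_k|\,\|d_k\|\le\frac14\|\tilde g_{k+1}\|$, and $\beta_k=\operatorname{sign}(\hat\beta_k)\frac{\|\tilde g_{k+1}\|}{4\|d_k\|}$ otherwise; set $\theta_{k+1}=\theta^{QN}_{k+1}$ if $\theta^{QN}_{k+1}$ is defined and lies in $[\frac14+\eta,\tau]$, and $\theta_{k+1}=1$ otherwise. Step 5. Set $d_{k+1}=-\theta_{k+1}\tilde g_{k+1}+\beta_kd_k$ and continue with $k+1$. It is assumed that step lengths satisfying Step 2 are found at every iteration performed. *)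

theory Defs
  imports "HOL-Analysis.Analysis" "HOL-Library.Landau_Symbols"
begin

definition subdifferential :: "('a::real_inner \<Rightarrow> real) \<Rightarrow> 'a \<Rightarrow> 'a set" where
  "subdifferential f x = {\<xi>. \<forall>y. f y \<ge> f x + \<xi> \<bullet> (y - x)}"

definition moreau_obj :: "('a::real_inner \<Rightarrow> real) \<Rightarrow> real \<Rightarrow> 'a \<Rightarrow> 'a \<Rightarrow> real" where
  "moreau_obj f lam x z = f z + 1 / (2 * lam) * (norm (z - x))\<^sup>2"

text \<open>The minimum over \<open>z\<close> is written as an infimum; lemma \<open>moreau_env_attained\<close> below
  shows that it is attained for continuous \<open>f\<close> bounded below and \<open>lam > 0\<close>.\<close>

definition moreau_env :: "('a::real_inner \<Rightarrow> real) \<Rightarrow> real \<Rightarrow> 'a \<Rightarrow> real" where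
  "moreau_env f lam x = (INF z. moreau_obj f lam x z)"

lemma moreau_env_attained:
  fixes f :: "'a::euclidean_space \<Rightarrow> real"
  assumes cont: "continuous_on UNIV f" and bdd: "bdd_below (range f)" and lam: "lam > 0"
  shows "\<exists>z. is_arg_min (moreau_obj f lam x) (\<lambda>_. True) z \<and> moreau_env f lam x = moreau_obj f lam x z"
proof -
  obtain b where b: "\<And>z. b \<le> f z"
    using bdd by (auto simp: bdd_below_def)
  define r where "r = sqrt (2 * lam * (f x - b))"
  have r0: "r \<ge> 0" using b[of x] lam by (simp add: r_def)
  have r2: "r\<^sup>2 = 2 * lam * (f x - b)" using b[of x] lam by (simp add: r_def)
  have "continuous_on (cball x r) (moreau_obj f lam x)"
    unfolding moreau_obj_def
    by (intro continuous_intros continuous_on_subset[OF cont]) auto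
  moreover have "cball x r \<noteq> {}" using r0 by simp
  ultimately obtain z where z: "\<And>w. w \<in> cball x r \<Longrightarrow> moreau_obj f lam x z \<le> moreau_obj f lam x w"
    using continuous_attains_inf[OF compact_cball] by blast
  have zx: "moreau_obj f lam x z \<le> f x"
    using z[of x] r0 by (simp add: moreau_obj_def)
  have le: "moreau_obj f lam x z \<le> moreau_obj f lam x w" for w
  proof (cases "w \<in> cball x r")
    case False
    hence "r < norm (w - x)" by (simp add: dist_norm norm_minus_commute)
    hence "r\<^sup>2 \<le> (norm (w - x))\<^sup>2" using r0 by (intro power_mono) auto
    hence "f x - b \<le> 1 / (2 * lam) * (norm (w - x))\<^sup>2"
      using lam by (simp add: r2 field_simps)
    thus ?thesis using zx b[of w] by (simp add: moreau_obj_def)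
  qed (use z in auto)
  have "moreau_env f lam x = moreau_obj f lam x z"
    unfolding moreau_env_def by (rule cInf_eq_minimum) (use le in auto)
  thus ?thesis using le by (auto simp: is_arg_min_linorder)
qed

text \<open>A choice \<open>pa\<close> of an inexact proximal point for every \<open>x\<close> and every tolerance \<open>\<epsilon> > 0\<close>.\<close>

definition inexact_prox ::
  "('a::real_inner \<Rightarrow> real) \<Rightarrow> real \<Rightarrow> ('a \<Rightarrow> real \<Rightarrow> 'a) \<Rightarrow> bool" where
  "inexact_prox f lam pa \<longleftrightarrow>
     (\<forall>x \<epsilon>. \<epsilon> > 0 \<longrightarrow> moreau_obj f lam x (pa x \<epsilon>) \<le> moreau_env f lam x + \<epsilon>)"

definition inexact_env ::
  "('a::real_inner \<Rightarrow> real) \<Rightarrow> real \<Rightarrow> ('a \<Rightarrow> real \<Rightarrow> 'a) \<Rightarrow> 'a \<Rightarrow> real \<Rightarrow> real" where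
  "inexact_env f lam pa x \<epsilon> = moreau_obj f lam x (pa x \<epsilon>)"

definition inexact_grad ::
  "real \<Rightarrow> ('a::real_vector \<Rightarrow> real \<Rightarrow> 'a) \<Rightarrow> 'a \<Rightarrow> real \<Rightarrow> 'a" where
  "inexact_grad lam pa x \<epsilon> = (1 / lam) *\<^sub>R (x - pa x \<epsilon>)"

text \<open>In the next four definitions \<open>d\<close> is the current direction, \<open>g'\<close> the new inexact gradient
  and \<open>y\<close> the difference of the new and the current inexact gradient.\<close>

definition beta_hat :: "'a::real_inner \<Rightarrow> 'a \<Rightarrow> 'a \<Rightarrow> real" where
  "beta_hat d g' y = (g' \<bullet> y) / (d \<bullet> y) - (norm y)\<^sup>2 * ((d \<bullet> g') / (d \<bullet> y)\<^sup>2)"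

definition theta_QN :: "'a::real_inner \<Rightarrow> 'a \<Rightarrow> 'a \<Rightarrow> real" where
  "theta_QN d g' y = 1 - (norm y)\<^sup>2 * ((d \<bullet> g') / ((d \<bullet> y) * (y \<bullet> g')))"

definition beta_W :: "real \<Rightarrow> 'a::real_inner \<Rightarrow> 'a \<Rightarrow> 'a \<Rightarrow> real" where
  "beta_W \<rho>\<^sub>0 d g' y =
     (if \<bar>d \<bullet> y\<bar> < \<rho>\<^sub>0 then 0
      else if \<bar>beta_hat d g' y\<bar> * norm d \<le> 1 / 4 * norm g' then beta_hat d g' y
      else sgn (beta_hat d g' y) * (norm g' / (4 * norm d)))"

text \<open>\<open>theta_QN\<close> is defined, in the sense of the algorithm, iff its denominator is nonzero.\<close>

definition theta_W :: "real \<Rightarrow> real \<Rightarrow> real \<Rightarrow> 'a::real_inner \<Rightarrow> 'a \<Rightarrow> 'a \<Rightarrow> real" where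
  "theta_W \<eta> \<tau> \<rho>\<^sub>0 d g' y =
     (if \<bar>d \<bullet> y\<bar> < \<rho>\<^sub>0 then 1
      else if (d \<bullet> y) * (y \<bullet> g') \<noteq> 0 \<and> theta_QN d g' y \<in> {1 / 4 + \<eta> .. \<tau>}
        then theta_QN d g' y
      else 1)"

text \<open>The infinite runs of the algorithm from \<open>x 0\<close> with initial tolerance \<open>\<epsilon> 0\<close>: the stopping
  test never succeeds, and \<open>\<epsilon> (k + 1)\<close> and \<open>\<alpha> k\<close> are any values satisfying the Wolfe-type
  conditions.\<close>

definition algorithm_W_run ::
  "('a::real_inner \<Rightarrow> real) \<Rightarrow> real \<Rightarrow> ('a \<Rightarrow> real \<Rightarrow> 'a) \<Rightarrow>
   real \<Rightarrow> real \<Rightarrow> real \<Rightarrow> real \<Rightarrow> real \<Rightarrow>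
   (nat \<Rightarrow> 'a) \<Rightarrow> (nat \<Rightarrow> 'a) \<Rightarrow> (nat \<Rightarrow> real) \<Rightarrow> (nat \<Rightarrow> real) \<Rightarrow> bool" where
  "algorithm_W_run f lam pa \<delta> \<sigma> \<eta> \<tau> \<rho>\<^sub>0 x d \<epsilon> \<alpha> \<longleftrightarrow>
     (let g = (\<lambda>k. inexact_grad lam pa (x k) (\<epsilon> k));
          y = (\<lambda>k. g (Suc k) - g k)
      in d 0 = - g 0 \<and>
         (\<forall>k. g k \<noteq> 0 \<and>
              0 < \<epsilon> (Suc k) \<and> \<epsilon> (Suc k) < \<epsilon> k \<and>
              \<alpha> k > 0 \<and>
              x (Suc k) = x k + \<alpha> k *\<^sub>R d k \<and>
              inexact_env f lam pa (x k + \<alpha> k *\<^sub>R d k) (\<epsilon> (Suc k)) - inexact_env f lam pa (x k) (\<epsilon> k)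
                \<le> \<delta> * \<alpha> k * (g k \<bullet> d k) \<and>
              g (Suc k) \<bullet> d k \<ge> \<sigma> * (g k \<bullet> d k) \<and>
              d (Suc k) = - (theta_W \<eta> \<tau> \<rho>\<^sub>0 (d k) (g (Suc k)) (y k) *\<^sub>R g (Suc k))
                          + beta_W \<rho>\<^sub>0 (d k) (g (Suc k)) (y k) *\<^sub>R d k))"

definition R_linearly_convergent :: "(nat \<Rightarrow> 'a::metric_space) \<Rightarrow> 'a \<Rightarrow> bool" where
  "R_linearly_convergent x l \<longleftrightarrow>
     x \<longlonglongrightarrow> l \<and> (\<exists>c r. 0 < r \<and> r < 1 \<and> (\<forall>k. dist (x k) l \<le> c * r ^ k))"

end

theory Submission
  imports Defs
begin

text \<open>
  The Moreau envelope \<open>F\<close> inherits strong convexity from \<open>f\<close>: with \<open>G x = (x - prox x) / lam\<close>, which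
  is both a subgradient of \<open>f\<close> at \<open>prox x\<close> and the gradient of \<open>F\<close> at \<open>x\<close>, one has
  \<open>F v \<ge> F u + G u \<bullet> (v - u) + \<nu> / 2 * \<parallel>v - u\<parallel>\<^sup>2\<close> (\<open>moreau_env_strong_lower_bound\<close>). This single
  inequality gives the uniqueness of the minimizer, the quadratic growth of \<open>F\<close> around it, and the
  Polyak--Lojasiewicz inequality \<open>2 * \<nu> * (F u - F\<^sup>\<star>) \<le> \<parallel>G u\<parallel>\<^sup>2\<close>. The
  lower bound itself rests on the optimality condition of the proximal problem
  (\<open>moreau_grad_subgradient\<close>) and the strong convexity of \<open>f\<close>.

  One iteration of the algorithm then contracts \<open>F (x k) - F\<^sup>\<star>\<close> by the factor \<open>\<rho>\<close>, up to an error
  proportional to \<open>\<epsilon> k\<close>. The truncated parameters keep the search direction close to a multiple of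
  \<open>- g k\<close>, so that \<open>- (g k \<bullet> d k)\<close> dominates both \<open>\<eta> * \<parallel>g k\<parallel>\<^sup>2\<close> and
  \<open>\<eta> / (\<tau> + 1 / 4)\<^sup>2 * \<parallel>d k\<parallel>\<^sup>2\<close>. The second bound, the curvature condition and the
  one-sided Lipschitz bound for \<open>G\<close> with constant \<open>1 / lam\<close> force \<open>\<alpha> k \<ge> m\<close> (\<open>step_length_lower_bound\<close>);
  the first bound and the decrease condition then yield a decrease of at least \<open>\<delta> * m * \<eta> * \<parallel>g k\<parallel>\<^sup>2\<close>. Replacing \<open>g k\<close>
  by \<open>G (x k)\<close> costs at most \<open>2 * \<epsilon> k / lam\<close> in squared norm, and the Polyak--Lojasiewicz
  inequality closes the recursion \<open>e (k + 1) \<le> \<rho> * e k + C * q ^ k\<close> for the error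
  \<open>e k = F (x k) - F\<^sup>\<star>\<close>, which \<open>perturbed_linear_recursion\<close> solves.
\<close>

section \<open>Proximal points and the Moreau envelope\<close>

definition prox :: "('a::real_inner \<Rightarrow> real) \<Rightarrow> real \<Rightarrow> 'a \<Rightarrow> 'a" where
  "prox f lam x = arg_min (moreau_obj f lam x) (\<lambda>_. True)"

definition moreau_grad :: "('a::real_inner \<Rightarrow> real) \<Rightarrow> real \<Rightarrow> 'a \<Rightarrow> 'a" where
  "moreau_grad f lam x = (1 / lam) *\<^sub>R (x - prox f lam x)"

locale convex_moreau =
  fixes f :: "'a::euclidean_space \<Rightarrow> real" and lam :: real
  assumes convex: "convex_on UNIV f"
    and bounded_below: "bdd_below (range f)"
    and lam_pos: "lam > 0"
begin

abbreviation F where "F \<equiv> moreau_env f lam"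
abbreviation P where "P \<equiv> prox f lam"
abbreviation G where "G \<equiv> moreau_grad f lam"

lemma continuous_f: "continuous_on UNIV f"
  using convex_on_continuous[OF open_UNIV convex] .

lemma prox_minimizes:
  shows "F x = moreau_obj f lam x (P x)" and "F x \<le> moreau_obj f lam x z"
proof -
  obtain w where w: "is_arg_min (moreau_obj f lam x) (\<lambda>_. True) w"
      and Fw: "F x = moreau_obj f lam x w"
    using moreau_env_attained[OF continuous_f bounded_below lam_pos] by blast
  have "is_arg_min (moreau_obj f lam x) (\<lambda>_. True) (P x)"
    unfolding prox_def arg_min_def by (rule someI[of _ w]) (rule w)
  with w Fw show "F x = moreau_obj f lam x (P x)" and "F x \<le> moreau_obj f lam x z"
    by (auto simp: is_arg_min_linorder intro: antisym)
qed

lemma prox_eq: "P x = x - lam *\<^sub>R G x"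
  using lam_pos by (simp add: moreau_grad_def)

lemma moreau_env_eq: "F x = f (P x) + lam / 2 * (norm (G x))\<^sup>2"
proof -
  have "P x - x = - (lam *\<^sub>R G x)" by (simp add: prox_eq)
  hence "norm (P x - x) = lam * norm (G x)" using lam_pos by simp
  thus ?thesis
    using prox_minimizes(1)[of x] lam_pos
    by (simp add: moreau_obj_def power_mult_distrib power2_eq_square)
qed

lemma moreau_env_le: "F x \<le> f x"
  using prox_minimizes(2)[of x x] by (simp add: moreau_obj_def)

text \<open>
  The optimality condition of the proximal problem. Convexity bounds \<open>f\<close> along the segment from
  \<open>P x\<close> to \<open>v\<close>; comparing the objective at \<open>P x\<close> and at the point with parameter \<open>t\<close> gives the
  subgradient inequality up to a term of order \<open>t\<close>, which vanishes as \<open>t\<close> tends to \<open>0\<close>.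
\<close>

lemma moreau_grad_subgradient: "G x \<in> subdifferential f (P x)"
  unfolding subdifferential_def
proof (intro CollectI allI)
  fix v
  define w where "w = v - P x"
  define D where "D = f v - f (P x) - G x \<bullet> w"
  have step: "0 \<le> D + t * ((norm w)\<^sup>2 / (2 * lam))" if t: "0 < t" "t < 1" for t
  proof -
    have pt: "(1 - t) *\<^sub>R P x + t *\<^sub>R v = P x + t *\<^sub>R w"
      by (simp add: w_def algebra_simps)
    have cv: "f (P x + t *\<^sub>R w) \<le> (1 - t) * f (P x) + t * f v"
      using convex_onD[OF convex, of t "P x" v] t by (simp add: pt)
    have "P x + t *\<^sub>R w - x = t *\<^sub>R w - lam *\<^sub>R G x" by (simp add: prox_eq)
    hence "(norm (P x + t *\<^sub>R w - x))\<^sup>2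
        = t\<^sup>2 * (norm w)\<^sup>2 - 2 * lam * t * (G x \<bullet> w) + lam\<^sup>2 * (norm (G x))\<^sup>2"
      unfolding power2_norm_eq_inner
      by (simp only:) (simp add: inner_diff inner_commute power2_eq_square)
    hence obj: "moreau_obj f lam x (P x + t *\<^sub>R w)
        = f (P x + t *\<^sub>R w) + t\<^sup>2 * (norm w)\<^sup>2 / (2 * lam) - t * (G x \<bullet> w)
          + lam / 2 * (norm (G x))\<^sup>2"
      using lam_pos by (simp add: moreau_obj_def field_simps power2_eq_square)
    have "0 \<le> t * (D + t * ((norm w)\<^sup>2 / (2 * lam)))"
      using prox_minimizes(2)[of x "P x + t *\<^sub>R w"] cv
      unfolding obj moreau_env_eq[of x]
      by (simp add: D_def algebra_simps power2_eq_square)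
    thus ?thesis using t by (simp add: zero_le_mult_iff)
  qed
  have "((\<lambda>t. D + t * ((norm w)\<^sup>2 / (2 * lam))) \<longlongrightarrow> D + 0 * ((norm w)\<^sup>2 / (2 * lam))) (at_right 0)"
    by (intro tendsto_intros)
  moreover have "\<forall>\<^sub>F t in at_right 0. 0 \<le> D + t * ((norm w)\<^sup>2 / (2 * lam))"
    using step by (auto simp: eventually_at_right[OF zero_less_one] intro!: exI[of _ 1])
  ultimately have "0 \<le> D + 0 * ((norm w)\<^sup>2 / (2 * lam))"
    by (rule tendsto_lowerbound) simp
  thus "f v \<ge> f (P x) + G x \<bullet> (v - P x)" by (simp add: D_def w_def)
qed

lemma subgradient_prox: "f v \<ge> f (P x) + G x \<bullet> (v - P x)"
  using moreau_grad_subgradient by (auto simp: subdifferential_def)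

text \<open>
  The quadratic term makes the proximal objective \<open>1 / lam\<close>-strongly convex, so an
  \<open>\<epsilon>\<close>-minimizer lies within distance \<open>sqrt (2 * lam * \<epsilon>)\<close> of the minimizer \<open>P x\<close>.
\<close>

lemma inexact_grad_error:
  assumes "inexact_prox f lam pa" and "\<epsilon> > 0"
  shows "(norm (inexact_grad lam pa x \<epsilon> - G x))\<^sup>2 \<le> 2 * \<epsilon> / lam"
proof -
  define u where "u = inexact_grad lam pa x \<epsilon> - G x"
  have pa: "pa x \<epsilon> = P x - lam *\<^sub>R u"
    using lam_pos by (simp add: u_def inexact_grad_def moreau_grad_def algebra_simps)
  hence "pa x \<epsilon> - x = - (lam *\<^sub>R (G x + u))" by (simp add: prox_eq algebra_simps)
  hence sq: "(norm (pa x \<epsilon> - x))\<^sup>2 = lam\<^sup>2 * (norm (G x + u))\<^sup>2"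
    using lam_pos by (simp add: power_mult_distrib)
  have "f (P x) - lam * (G x \<bullet> u) + lam / 2 * (norm (G x + u))\<^sup>2
      \<le> moreau_obj f lam x (pa x \<epsilon>)"
    using subgradient_prox[of x "pa x \<epsilon>"] lam_pos
    unfolding moreau_obj_def sq by (simp add: pa power2_eq_square)
  also have "\<dots> \<le> F x + \<epsilon>" using assms by (simp add: inexact_prox_def)
  finally have "lam / 2 * (norm u)\<^sup>2 \<le> \<epsilon>"
    unfolding moreau_env_eq power2_norm_eq_inner
    by (simp add: inner_add inner_commute algebra_simps)
  thus ?thesis using lam_pos by (simp add: u_def[symmetric] field_simps)
qed

lemma inexact_env_bounds:
  assumes "inexact_prox f lam pa" and "\<epsilon> > 0"
  shows "F x \<le> inexact_env f lam pa x \<epsilon>" and "inexact_env f lam pa x \<epsilon> \<le> F x + \<epsilon>"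
  using assms prox_minimizes(2) by (auto simp: inexact_env_def inexact_prox_def)

text \<open>
  The subgradient inequalities at \<open>P u\<close> and \<open>P v\<close> add up to \<open>0 \<le> (G v - G u) \<bullet> (P v - P u)\<close>. As
  \<open>v - u\<close> is \<open>P v - P u\<close> plus \<open>lam\<close> times \<open>G v - G u\<close>, its squared norm exceeds
  \<open>lam * ((G v - G u) \<bullet> (v - u))\<close> by a sum of nonnegative terms.
\<close>

lemma moreau_grad_one_sided_Lipschitz:
  "(G v - G u) \<bullet> (v - u) \<le> (norm (v - u))\<^sup>2 / lam"
proof -
  have mono: "0 \<le> (G v - G u) \<bullet> (P v - P u)"
    using subgradient_prox[of u "P v"] subgradient_prox[of v "P u"]
    by (simp add: inner_diff)
  define A where "A = G v - G u"
  define B where "B = P v - P u"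
  have vu: "v - u = B + lam *\<^sub>R A" by (simp add: A_def B_def prox_eq algebra_simps)
  have "(norm (v - u))\<^sup>2 - lam * (A \<bullet> (v - u)) = (norm B)\<^sup>2 + lam * (A \<bullet> B)"
    unfolding vu power2_norm_eq_inner
    by (simp add: inner_add inner_commute algebra_simps)
  also have "\<dots> \<ge> 0" using mono lam_pos by (simp add: A_def B_def)
  finally show ?thesis using lam_pos by (simp add: A_def field_simps)
qed

text \<open>Evaluating \<open>F\<close> at the proximal point of a minimizer shows that the two coincide.\<close>

lemma moreau_grad_minimizer:
  assumes "is_arg_min F (\<lambda>_. True) z"
  shows "G z = 0"
proof -
  have "F z \<le> F (P z)" using assms by (simp add: is_arg_min_linorder)
  also have "\<dots> \<le> f (P z)" by (rule moreau_env_le)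
  finally have "lam / 2 * (norm (G z))\<^sup>2 \<le> 0" by (simp add: moreau_env_eq)
  thus ?thesis using lam_pos by (simp add: mult_le_0_iff)
qed

end

section \<open>Strong convexity of the envelope\<close>

text \<open>
  Splitting \<open>w\<close> as \<open>u + (w - u)\<close> costs least when \<open>u = w / (1 + lam * \<mu>)\<close>; the resulting constant is
  the harmonic combination of \<open>\<mu>\<close> and \<open>1 / lam\<close>. The difference of the two sides is a multiple of
  the square of \<open>(1 + lam * \<mu>) * u - w\<close>.
\<close>

lemma parallel_sum_quadratic:
  fixes u w :: "'a::real_inner"
  assumes "lam > 0" "\<mu> > 0"
  shows "\<mu> / (1 + lam * \<mu>) / 2 * (norm w)\<^sup>2
    \<le> \<mu> / 2 * (norm u)\<^sup>2 + (norm (u - w))\<^sup>2 / (2 * lam)"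
proof -
  define s where "s = 1 + lam * \<mu>"
  have s: "s > 0" using assms by (simp add: s_def add_pos_pos)
  have mu: "\<mu> = (s - 1) / lam" using assms by (simp add: s_def)
  have "\<mu> / 2 * (norm u)\<^sup>2 + (norm (u - w))\<^sup>2 / (2 * lam) - \<mu> / s / 2 * (norm w)\<^sup>2
      = (norm (s *\<^sub>R u - w))\<^sup>2 / (2 * lam * s)"
    unfolding power2_norm_eq_inner mu
    using assms s by (simp add: inner_diff inner_commute field_simps)
  also have "\<dots> \<ge> 0" using assms s by simp
  finally show ?thesis by (simp add: s_def)
qed

locale strongly_convex_moreau = convex_moreau f lam
  for f :: "'a::euclidean_space \<Rightarrow> real" and lam :: real +
  fixes \<mu> :: real
  assumes mu_pos: "\<mu> > 0"
    and strong: "\<And>u v \<xi>. \<xi> \<in> subdifferential f u \<Longrightarrow>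
      f v \<ge> f u + \<xi> \<bullet> (v - u) + \<mu> / 2 * (norm (v - u))\<^sup>2"
begin

definition \<nu> where "\<nu> = \<mu> / (1 + lam * \<mu>)"

lemma nu_pos: "\<nu> > 0"
  using mu_pos lam_pos by (simp add: \<nu>_def add_pos_pos)

text \<open>
  Applying strong convexity of \<open>f\<close> at \<open>P u\<close> towards \<open>P v\<close> and expanding
  the proximal term of \<open>F v\<close> around that of \<open>F u\<close> leaves exactly the two quadratic terms which
  \<open>parallel_sum_quadratic\<close> bounds from below.
\<close>

lemma moreau_env_strong_lower_bound:
  "F v \<ge> F u + G u \<bullet> (v - u) + \<nu> / 2 * (norm (v - u))\<^sup>2"
proof -
  define a where "a = P v - P u"
  define w where "w = v - u"
  have "P v - v = (a - w) - lam *\<^sub>R G u" by (simp add: a_def w_def prox_eq)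
  hence "(norm (P v - v))\<^sup>2
      = (norm (a - w))\<^sup>2 - 2 * lam * (G u \<bullet> (a - w)) + lam\<^sup>2 * (norm (G u))\<^sup>2"
    unfolding power2_norm_eq_inner
    by (simp only:) (simp add: inner_diff inner_commute power2_eq_square algebra_simps)
  hence Fv: "F v = f (P v) + (norm (a - w))\<^sup>2 / (2 * lam) - G u \<bullet> (a - w)
      + lam / 2 * (norm (G u))\<^sup>2"
    using prox_minimizes(1)[of v] lam_pos
    by (simp add: moreau_obj_def field_simps power2_eq_square)
  have "f (P v) \<ge> f (P u) + G u \<bullet> a + \<mu> / 2 * (norm a)\<^sup>2"
    unfolding a_def by (rule strong[OF moreau_grad_subgradient])
  moreover have "\<nu> / 2 * (norm w)\<^sup>2 \<le> \<mu> / 2 * (norm a)\<^sup>2 + (norm (a - w))\<^sup>2 / (2 * lam)"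
    unfolding \<nu>_def by (rule parallel_sum_quadratic[OF lam_pos mu_pos])
  ultimately show ?thesis
    unfolding Fv moreau_env_eq[of u] by (simp add: w_def[symmetric] inner_diff_right)
qed

text \<open>
  Outside a ball the quadratic term of the strong subgradient inequality dominates the linear one,
  so \<open>f\<close> attains its minimum, and the value of the envelope there is that minimum.
\<close>

lemma moreau_env_minimizer_exists: "\<exists>z. is_arg_min F (\<lambda>_. True) z"
proof -
  define c where "c = P 0"
  define r where "r = 2 * norm (G 0) / \<mu>"
  have r: "r \<ge> 0" using mu_pos by (simp add: r_def)
  have "continuous_on (cball c r) f" by (rule continuous_on_subset[OF continuous_f]) simp
  then obtain z where z: "\<And>v. v \<in> cball c r \<Longrightarrow> f z \<le> f v"
    using continuous_attains_inf[OF compact_cball, of c r f] r by (metis cball_eq_empty not_less)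
  have min: "f z \<le> f v" for v
  proof (cases "v \<in> cball c r")
    case False
    hence "r \<le> norm (v - c)" by (simp add: dist_norm norm_minus_commute)
    hence "norm (G 0) \<le> \<mu> / 2 * norm (v - c)" using mu_pos by (simp add: r_def field_simps)
    hence "norm (G 0) * norm (v - c) \<le> \<mu> / 2 * norm (v - c) * norm (v - c)"
      by (rule mult_right_mono) simp
    hence "norm (G 0) * norm (v - c) \<le> \<mu> / 2 * (norm (v - c))\<^sup>2"
      by (simp add: power2_eq_square)
    moreover have "- (norm (G 0) * norm (v - c)) \<le> G 0 \<bullet> (v - c)"
      using Cauchy_Schwarz_ineq2[of "G 0" "v - c"] by linarith
    moreover have "f v \<ge> f c + G 0 \<bullet> (v - c) + \<mu> / 2 * (norm (v - c))\<^sup>2"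
      unfolding c_def by (rule strong[OF moreau_grad_subgradient])
    moreover have "f z \<le> f c" using z[of c] r by simp
    ultimately show ?thesis by linarith
  qed (rule z)
  have "F z \<le> F y" for y
  proof -
    have "F z \<le> f (P y)" using moreau_env_le[of z] min[of "P y"] by linarith
    also have "\<dots> \<le> F y" using lam_pos by (simp add: moreau_env_eq)
    finally show ?thesis .
  qed
  thus ?thesis by (auto simp: is_arg_min_linorder)
qed

lemma quadratic_growth:
  assumes "is_arg_min F (\<lambda>_. True) z"
  shows "\<nu> / 2 * (norm (v - z))\<^sup>2 \<le> F v - F z"
  using moreau_env_strong_lower_bound[of z v] by (simp add: moreau_grad_minimizer[OF assms])

lemma moreau_env_minimizer_unique: "\<exists>!z. is_arg_min F (\<lambda>_. True) z"
proof (rule ex_ex1I[OF moreau_env_minimizer_exists])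
  fix y z assume y: "is_arg_min F (\<lambda>_. True) y" and z: "is_arg_min F (\<lambda>_. True) z"
  have "F y \<le> F z" using y by (simp add: is_arg_min_linorder)
  with quadratic_growth[OF z, of y] have "\<nu> / 2 * (norm (y - z))\<^sup>2 \<le> 0" by linarith
  thus "y = z" using nu_pos by (simp add: mult_le_0_iff)
qed

text \<open>
  Minimizing the right-hand side of the strong lower bound over all \<open>v\<close> (completing the square)
  gives the Polyak--Lojasiewicz inequality.
\<close>

lemma Polyak_Lojasiewicz: "2 * \<nu> * (F u - F v) \<le> (norm (G u))\<^sup>2"
proof -
  have "0 \<le> (norm (G u + \<nu> *\<^sub>R (v - u)))\<^sup>2" by simp
  also have "\<dots> = (norm (G u))\<^sup>2 + 2 * \<nu> * (G u \<bullet> (v - u) + \<nu> / 2 * (norm (v - u))\<^sup>2)"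
    unfolding power2_norm_eq_inner by (simp add: inner_add inner_commute algebra_simps)
  also have "\<dots> \<le> (norm (G u))\<^sup>2 + 2 * \<nu> * (F v - F u)"
    using moreau_env_strong_lower_bound[of u v] nu_pos by simp
  finally show ?thesis by (simp add: algebra_simps)
qed

end

section \<open>Search directions of the algorithm\<close>

lemma beta_W_bound: "\<bar>beta_W \<rho>\<^sub>0 d g y\<bar> * norm d \<le> norm g / 4"
  by (cases "d = 0") (auto simp: beta_W_def abs_mult abs_sgn_eq)

lemma theta_W_cases: "theta_W \<eta> \<tau> \<rho>\<^sub>0 d g y \<in> {1 / 4 + \<eta> .. \<tau>} \<or> theta_W \<eta> \<tau> \<rho>\<^sub>0 d g y = 1"
  by (auto simp: theta_W_def)

text \<open>
  The direction is \<open>- \<theta> * g\<close> plus a perturbation \<open>b\<close> of at most a quarter of the length of \<open>g\<close>. If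
  \<open>\<theta>\<close> lies in \<open>[1 / 4 + \<eta>, \<tau>]\<close>, the second claim follows from the first and
  \<open>\<parallel>d\<parallel> \<le> (\<tau> + 1 / 4) * \<parallel>g\<parallel>\<close>. The default value \<open>\<theta> = 1\<close> may exceed \<open>\<tau>\<close>; then \<open>\<parallel>b\<parallel> \<le> \<parallel>g\<parallel>\<close> gives
  \<open>\<parallel>d\<parallel>\<^sup>2 \<le> - 2 * (g \<bullet> d)\<close>, and \<open>\<eta> / (\<tau> + 1 / 4)\<^sup>2 \<le> 1 / 2\<close> because
  \<open>(\<tau> + 1 / 4)\<^sup>2 \<ge> (\<eta> + 1 / 2)\<^sup>2 \<ge> 2 * \<eta>\<close>.
\<close>

lemma descent_direction:
  fixes g b :: "'a::real_inner"
  assumes eta: "0 < \<eta>" "\<eta> < 3 / 4" and tau: "\<tau> > 1 / 4 + \<eta>"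
    and theta: "\<theta> \<in> {1 / 4 + \<eta> .. \<tau>} \<or> \<theta> = 1"
    and b: "norm b \<le> norm g / 4" and d: "d = - (\<theta> *\<^sub>R g) + b"
  shows "\<eta> * (norm g)\<^sup>2 \<le> - (g \<bullet> d)"
    and "\<eta> / (\<tau> + 1 / 4)\<^sup>2 * (norm d)\<^sup>2 \<le> - (g \<bullet> d)"
proof -
  have gb: "\<bar>g \<bullet> b\<bar> \<le> (norm g)\<^sup>2 / 4"
    using Cauchy_Schwarz_ineq2[of g b] mult_left_mono[OF b norm_ge_zero[of g]]
    by (simp add: power2_eq_square)
  have gd: "- (g \<bullet> d) = \<theta> * (norm g)\<^sup>2 - g \<bullet> b"
    by (simp add: d inner_add_right inner_diff_right power2_norm_eq_inner)
  have "(1 / 4 + \<eta>) * (norm g)\<^sup>2 \<le> \<theta> * (norm g)\<^sup>2"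
    using theta eta by (intro mult_right_mono) auto
  thus first: "\<eta> * (norm g)\<^sup>2 \<le> - (g \<bullet> d)"
    using gb unfolding gd by (simp add: algebra_simps)
  have s: "(\<tau> + 1 / 4)\<^sup>2 > 0" using eta tau by simp
  from theta show "\<eta> / (\<tau> + 1 / 4)\<^sup>2 * (norm d)\<^sup>2 \<le> - (g \<bullet> d)"
  proof
    assume th: "\<theta> \<in> {1 / 4 + \<eta> .. \<tau>}"
    have "norm d \<le> norm (\<theta> *\<^sub>R g) + norm b"
      unfolding d using norm_triangle_ineq[of "- (\<theta> *\<^sub>R g)" b] by simp
    also have "\<dots> \<le> \<tau> * norm g + norm g / 4"
      using th eta b by (intro add_mono) (auto intro: mult_right_mono)
    finally have "norm d \<le> (\<tau> + 1 / 4) * norm g" by (simp add: algebra_simps)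
    hence "(norm d)\<^sup>2 \<le> (\<tau> + 1 / 4)\<^sup>2 * (norm g)\<^sup>2"
      unfolding power_mult_distrib[symmetric] by (rule power_mono) simp
    hence "\<eta> * (norm d)\<^sup>2 / (\<tau> + 1 / 4)\<^sup>2 \<le> \<eta> * (norm g)\<^sup>2"
      using s eta by (simp add: pos_divide_le_eq mult.assoc mult.commute[of "(norm g)\<^sup>2"])
    with first show ?thesis by simp
  next
    assume th: "\<theta> = 1"
    have "(norm b)\<^sup>2 \<le> (norm g)\<^sup>2"
      using b norm_ge_zero[of b] norm_ge_zero[of g] by (intro power_mono) linarith+
    moreover have "(norm d)\<^sup>2 = (norm g)\<^sup>2 - 2 * (g \<bullet> b) + (norm b)\<^sup>2"
      unfolding d th power2_norm_eq_inner by (simp add: inner_add inner_diff inner_commute)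
    ultimately have half: "(norm d)\<^sup>2 / 2 \<le> - (g \<bullet> d)"
      unfolding gd th by simp
    have "2 * \<eta> \<le> (\<eta> + 1 / 2)\<^sup>2"
      using zero_le_power2[of "\<eta> - 1 / 2"] by (simp add: power2_eq_square algebra_simps)
    also have "\<dots> \<le> (\<tau> + 1 / 4)\<^sup>2" using eta tau by (intro power_mono) auto
    finally have "\<eta> / (\<tau> + 1 / 4)\<^sup>2 \<le> 1 / 2" using s by (simp add: field_simps)
    hence "\<eta> / (\<tau> + 1 / 4)\<^sup>2 * (norm d)\<^sup>2 \<le> 1 / 2 * (norm d)\<^sup>2"
      by (intro mult_right_mono) auto
    with half show ?thesis by linarith
  qed
qed

lemma algorithm_W_run_descent_direction:
  fixes x d :: "nat \<Rightarrow> 'a::real_inner"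
  assumes run: "algorithm_W_run f lam pa \<delta> \<sigma> \<eta> \<tau> \<rho>\<^sub>0 x d \<epsilon> \<alpha>"
    and eta: "0 < \<eta>" "\<eta> < 3 / 4" and tau: "\<tau> > 1 / 4 + \<eta>"
  defines "g \<equiv> \<lambda>k. inexact_grad lam pa (x k) (\<epsilon> k)"
  shows "\<eta> * (norm (g k))\<^sup>2 \<le> - (g k \<bullet> d k)"
    and "\<eta> / (\<tau> + 1 / 4)\<^sup>2 * (norm (d k))\<^sup>2 \<le> - (g k \<bullet> d k)"
proof -
  obtain \<theta> b where "\<theta> \<in> {1 / 4 + \<eta> .. \<tau>} \<or> \<theta> = 1" "norm b \<le> norm (g k) / 4"
      "d k = - (\<theta> *\<^sub>R g k) + b"
  proof (cases k)
    case 0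
    show ?thesis
      by (rule that[of 1 0]) (use run in \<open>simp_all add: 0 algorithm_W_run_def Let_def g_def\<close>)
  next
    case (Suc j)
    define y where "y = g (Suc j) - g j"
    show ?thesis
    proof (rule that)
      show "norm (beta_W \<rho>\<^sub>0 (d j) (g (Suc j)) y *\<^sub>R d j) \<le> norm (g k) / 4"
        using beta_W_bound by (simp add: Suc)
      show "d k = - (theta_W \<eta> \<tau> \<rho>\<^sub>0 (d j) (g (Suc j)) y *\<^sub>R g k)
          + beta_W \<rho>\<^sub>0 (d j) (g (Suc j)) y *\<^sub>R d j"
        using run by (simp add: Suc algorithm_W_run_def Let_def g_def y_def)
    qed (rule theta_W_cases)
  qed
  thus "\<eta> * (norm (g k))\<^sup>2 \<le> - (g k \<bullet> d k)"
    and "\<eta> / (\<tau> + 1 / 4)\<^sup>2 * (norm (d k))\<^sup>2 \<le> - (g k \<bullet> d k)"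
    using descent_direction[OF eta tau] by blast+
qed

section \<open>Step lengths\<close>

text \<open>
  By the curvature condition \<open>g\<close> has to change along \<open>d\<close> by at least
  \<open>(1 - \<sigma>) * (- (g \<bullet> d)) \<ge> m\<^sub>0 / lam * \<parallel>d\<parallel>\<^sup>2\<close>. The exact gradient changes by at most
  \<open>\<alpha> / lam * \<parallel>d\<parallel>\<^sup>2\<close>, and the two gradient errors, each at most \<open>m\<^sub>0 / (4 * lam) * \<parallel>d\<parallel>\<close>, account for
  at most half of the required change.
\<close>

lemma (in convex_moreau) step_length_lower_bound:
  assumes alpha: "\<alpha> > 0" and d: "d \<noteq> 0" and sigma: "\<sigma> < 1" and m0: "m\<^sub>0 \<ge> 0"
    and slope: "m\<^sub>0 / lam * (norm d)\<^sup>2 \<le> (1 - \<sigma>) * (- (g \<bullet> d))"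
    and curvature: "g' \<bullet> d \<ge> \<sigma> * (g \<bullet> d)"
    and err: "(norm (g - G x))\<^sup>2 \<le> 2 * \<epsilon> / lam" "(norm (g' - G (x + \<alpha> *\<^sub>R d)))\<^sup>2 \<le> 2 * \<epsilon>' / lam"
    and eps: "\<epsilon>' \<le> \<epsilon>" "\<epsilon> \<le> m\<^sub>0\<^sup>2 / (32 * lam) * (norm d)\<^sup>2"
  shows "m\<^sub>0 / 2 \<le> \<alpha>"
proof -
  define N where "N = norm d"
  have N: "N > 0" using d by (simp add: N_def)
  have "2 * \<epsilon> / lam \<le> (m\<^sub>0 / (4 * lam) * N)\<^sup>2"
    using eps lam_pos by (simp add: N_def field_simps power2_eq_square)
  moreover have "2 * \<epsilon>' / lam \<le> 2 * \<epsilon> / lam" using eps lam_pos by (simp add: divide_right_mono)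
  ultimately have sq: "(norm (g - G x))\<^sup>2 \<le> (m\<^sub>0 / (4 * lam) * N)\<^sup>2"
      "(norm (g' - G (x + \<alpha> *\<^sub>R d)))\<^sup>2 \<le> (m\<^sub>0 / (4 * lam) * N)\<^sup>2"
    using err by linarith+
  have "0 \<le> m\<^sub>0 / (4 * lam) * N" using m0 lam_pos N by simp
  with sq have n: "norm (g - G x) \<le> m\<^sub>0 / (4 * lam) * N"
      "norm (g' - G (x + \<alpha> *\<^sub>R d)) \<le> m\<^sub>0 / (4 * lam) * N"
    by (auto intro: power2_le_imp_le)
  have e1: "- ((g - G x) \<bullet> d) \<le> m\<^sub>0 / (4 * lam) * N\<^sup>2"
    using Cauchy_Schwarz_ineq2[of "g - G x" d] mult_right_mono[OF n(1), of N] N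
    by (simp add: N_def power2_eq_square)
  have e2: "(g' - G (x + \<alpha> *\<^sub>R d)) \<bullet> d \<le> m\<^sub>0 / (4 * lam) * N\<^sup>2"
    using Cauchy_Schwarz_ineq2[of "g' - G (x + \<alpha> *\<^sub>R d)" d] mult_right_mono[OF n(2), of N] N
    by (simp add: N_def power2_eq_square)
  have "\<alpha> * ((G (x + \<alpha> *\<^sub>R d) - G x) \<bullet> d) \<le> \<alpha> * (\<alpha> / lam * N\<^sup>2)"
    using moreau_grad_one_sided_Lipschitz[of "x + \<alpha> *\<^sub>R d" x] alpha
    by (simp add: N_def power2_eq_square mult.assoc mult.left_commute)
  hence lip: "(G (x + \<alpha> *\<^sub>R d) - G x) \<bullet> d \<le> \<alpha> / lam * N\<^sup>2"
    using alpha by (rule mult_left_le_imp_le)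
  have "m\<^sub>0 / lam * N\<^sup>2 \<le> (g' - g) \<bullet> d"
    using slope curvature by (simp add: N_def inner_diff_left algebra_simps)
  also have "\<dots> = (G (x + \<alpha> *\<^sub>R d) - G x) \<bullet> d + (g' - G (x + \<alpha> *\<^sub>R d)) \<bullet> d - (g - G x) \<bullet> d"
    by (simp add: inner_diff_left)
  also have "\<dots> \<le> \<alpha> / lam * N\<^sup>2 + m\<^sub>0 / (4 * lam) * N\<^sup>2 + m\<^sub>0 / (4 * lam) * N\<^sup>2"
    using lip e1 e2 by linarith
  also have "\<dots> = (\<alpha> / lam + m\<^sub>0 / (2 * lam)) * N\<^sup>2"
    by (simp add: field_simps)
  finally have "m\<^sub>0 / lam \<le> \<alpha> / lam + m\<^sub>0 / (2 * lam)"
    using N by (subst (asm) mult_le_cancel_right_pos) auto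
  thus ?thesis using lam_pos by (simp add: field_simps)
qed

section \<open>Linear convergence\<close>

text \<open>
  The accumulated perturbation is \<open>C\<close> times the sum of \<open>\<rho> ^ (k - 1 - j) * q ^ j\<close> over \<open>j < k\<close>,
  which is \<open>C * (\<rho> ^ k - q ^ k) / (\<rho> - q)\<close>.
\<close>

lemma perturbed_linear_recursion:
  fixes e :: "nat \<Rightarrow> real"
  assumes rec: "\<And>k. e (Suc k) \<le> \<rho> * e k + C * q ^ k"
    and "0 \<le> C" "0 \<le> q" "q < \<rho>"
  shows "e k \<le> (e 0 + C / (\<rho> - q)) * \<rho> ^ k"
proof -
  have "e k \<le> e 0 * \<rho> ^ k + C / (\<rho> - q) * (\<rho> ^ k - q ^ k)"
  proof (induction k)
    case (Suc k)
    have "e (Suc k) \<le> \<rho> * e k + C * q ^ k" by (rule rec)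
    also have "\<dots> \<le> \<rho> * (e 0 * \<rho> ^ k + C / (\<rho> - q) * (\<rho> ^ k - q ^ k)) + C * q ^ k"
      using Suc assms by (intro add_right_mono mult_left_mono) auto
    also have "C * q ^ k = C / (\<rho> - q) * ((\<rho> - q) * q ^ k)" using assms by simp
    finally show ?case by (simp add: algebra_simps)
  qed simp
  moreover have "0 \<le> C / (\<rho> - q) * q ^ k" using assms by simp
  ultimately show ?thesis by (simp add: algebra_simps)
qed

lemma R_linearly_convergentI:
  assumes r: "0 < r" "r < 1" and bound: "\<And>k. dist (x k) l \<le> c * r ^ k"
  shows "R_linearly_convergent x l"
proof -
  have "(\<lambda>k. c * r ^ k) \<longlonglongrightarrow> c * 0"
    using r by (intro tendsto_mult tendsto_const LIMSEQ_realpow_zero) auto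
  hence "(\<lambda>k. dist (x k) l) \<longlonglongrightarrow> 0"
    by (intro tendsto_sandwich[of "\<lambda>_. 0" "\<lambda>k. dist (x k) l" _ "\<lambda>k. c * r ^ k"])
      (use bound in auto)
  hence "x \<longlonglongrightarrow> l" by (rule tendsto_dist_iff[THEN iffD2])
  thus ?thesis
    unfolding R_linearly_convergent_def using r bound by blast
qed

theorem theorem3p6:
  fixes f F :: "real ^ 'n \<Rightarrow> real"
    and pa :: "real ^ 'n \<Rightarrow> real \<Rightarrow> real ^ 'n"
    and x d :: "nat \<Rightarrow> real ^ 'n"
    and \<epsilon> \<alpha> :: "nat \<Rightarrow> real"
    and lam \<delta> \<sigma> \<eta> \<tau> \<rho>\<^sub>0 m\<^sub>0 m \<gamma> \<mu> \<nu> \<rho> q :: real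
  assumes "convex_on UNIV f"
    and "local_lipschitz (UNIV :: real set) UNIV (\<lambda>_. f)"
    and "lam > 0"
    and "F = moreau_env f lam"
    and "0 < \<delta>" "\<delta> \<le> \<sigma>" "\<sigma> < 1"
    and "0 < \<eta>" "\<eta> < 3 / 4"
    and "\<tau> > 1 / 4 + \<eta>"
    and "0 < \<epsilon> 0" "\<epsilon> 0 < 1"
    and "\<rho>\<^sub>0 > 0"
    and "inexact_prox f lam pa"
    and "algorithm_W_run f lam pa \<delta> \<sigma> \<eta> \<tau> \<rho>\<^sub>0 x d \<epsilon> \<alpha>"
    and "m\<^sub>0 = lam * (1 - \<sigma>) * \<eta> / (\<tau> + 1 / 4)\<^sup>2"
    and "m = m\<^sub>0 / 2"
    and "bdd_below (range f)"
    and "decseq \<epsilon>" "\<epsilon> \<longlonglongrightarrow> 0"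
    and "\<epsilon> \<in> o(\<lambda>k. (norm (d k))\<^sup>2)"
    and "0 < \<gamma>" "\<gamma> \<le> m\<^sub>0\<^sup>2 / (32 * lam)"
    and "\<forall>k. \<epsilon> k \<le> \<gamma> * (norm (d k))\<^sup>2"
    and "\<mu> > 0"
    and "\<forall>u v. \<forall>\<xi>\<in>subdifferential f u. f v \<ge> f u + \<xi> \<bullet> (v - u) + \<mu> / 2 * (norm (v - u))\<^sup>2"
    and "\<nu> = \<mu> / (1 + lam * \<mu>)"
    and "\<rho> = 1 - \<delta> * m * \<eta> * \<nu>"
    and "0 < \<rho>" "\<rho> < 1"
    and "0 < q" "q < \<rho>"
    and "\<forall>k. \<epsilon> k \<le> \<epsilon> 0 * q ^ k"
  shows "(\<exists>!xstar. is_arg_min F (\<lambda>_. True) xstar) \<and>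
    (\<forall>xstar. is_arg_min F (\<lambda>_. True) xstar \<longrightarrow>
      (let Fstar = F xstar;
           C = (1 + 2 * \<delta> * m * \<eta> / lam) * \<epsilon> 0;
           K = (F (x 0) - Fstar) + C / (\<rho> - q)
       in (\<forall>k. F (x k) - Fstar \<le> K * \<rho> ^ k \<and>
               norm (x k - xstar) \<le> sqrt (2 * K / \<nu>) * \<rho> powr (real k / 2)) \<and>
          R_linearly_convergent x xstar))"
proof -
  interpret strongly_convex_moreau f lam \<mu>
    using assms by unfold_locales auto
  have F: "F = moreau_env f lam" and nu: "\<nu> = strongly_convex_moreau.\<nu> lam \<mu>"
    using assms \<nu>_def by auto
  define g where "g = (\<lambda>k. inexact_grad lam pa (x k) (\<epsilon> k))"
  have run: "algorithm_W_run f lam pa \<delta> \<sigma> \<eta> \<tau> \<rho>\<^sub>0 x d \<epsilon> \<alpha>" by fact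
  have eps: "\<epsilon> k > 0" for k
    using run \<open>0 < \<epsilon> 0\<close> by (cases k) (auto simp: algorithm_W_run_def Let_def)
  have g0: "g k \<noteq> 0" and eps_dec: "\<epsilon> (Suc k) < \<epsilon> k" and alpha: "\<alpha> k > 0"
    and xS: "x (Suc k) = x k + \<alpha> k *\<^sub>R d k"
    for k
    using run by (simp_all add: algorithm_W_run_def Let_def g_def)
  have decrease: "inexact_env f lam pa (x (Suc k)) (\<epsilon> (Suc k)) - inexact_env f lam pa (x k) (\<epsilon> k)
        \<le> \<delta> * \<alpha> k * (g k \<bullet> d k)"
    and curvature: "g (Suc k) \<bullet> d k \<ge> \<sigma> * (g k \<bullet> d k)" for k
    using run by (simp_all add: algorithm_W_run_def Let_def g_def xS)
  have desc: "\<eta> * (norm (g k))\<^sup>2 \<le> - (g k \<bullet> d k)"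
    and slope: "\<eta> / (\<tau> + 1 / 4)\<^sup>2 * (norm (d k))\<^sup>2 \<le> - (g k \<bullet> d k)" for k
    unfolding g_def
    using algorithm_W_run_descent_direction[OF run] assms by blast+
  have err: "(norm (g k - G (x k)))\<^sup>2 \<le> 2 * \<epsilon> k / lam" for k
    unfolding g_def by (rule inexact_grad_error) (use assms eps in auto)
  have m0: "m\<^sub>0 > 0" using assms by simp
  have step: "m \<le> \<alpha> k" for k
  proof -
    \<comment> \<open>The stopping test never succeeds, so \<open>d k\<close> is a strict descent direction.\<close>
    have "0 < \<eta> * (norm (g k))\<^sup>2" using g0 \<open>0 < \<eta>\<close> by simp
    with desc[of k] have dk: "d k \<noteq> 0" by auto
    have "m\<^sub>0 / lam * (norm (d k))\<^sup>2 = (1 - \<sigma>) * (\<eta> / (\<tau> + 1 / 4)\<^sup>2 * (norm (d k))\<^sup>2)"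
      using assms by simp
    also have "\<dots> \<le> (1 - \<sigma>) * (- (g k \<bullet> d k))"
      using slope[of k] \<open>\<sigma> < 1\<close> by (intro mult_left_mono) auto
    finally have sl: "m\<^sub>0 / lam * (norm (d k))\<^sup>2 \<le> (1 - \<sigma>) * (- (g k \<bullet> d k))" .
    have "\<epsilon> k \<le> \<gamma> * (norm (d k))\<^sup>2" using assms by blast
    also have "\<dots> \<le> m\<^sub>0\<^sup>2 / (32 * lam) * (norm (d k))\<^sup>2"
      using assms by (intro mult_right_mono) auto
    finally have "m\<^sub>0 / 2 \<le> \<alpha> k"
      using step_length_lower_bound[OF alpha dk \<open>\<sigma> < 1\<close> _ sl curvature err]
        err[of "Suc k"] eps_dec[of k] m0 by (simp add: xS less_imp_le)
    thus ?thesis using assms by simp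
  qed
  define c where "c = \<delta> * m * \<eta>"
  have c: "c > 0" using assms m0 by (simp add: c_def)
  define C where "C = (1 + 2 * \<delta> * m * \<eta> / lam) * \<epsilon> 0"
  have C: "C = (1 + 2 * c / lam) * \<epsilon> 0" by (simp add: C_def c_def)
  have C0: "C \<ge> 0" using c assms by (simp add: C)
  have contraction: "F (x (Suc k)) - F z \<le> \<rho> * (F (x k) - F z) + C * q ^ k"
    for z k
  proof -
    have "\<delta> * \<alpha> k * (g k \<bullet> d k) \<le> \<delta> * \<alpha> k * (- (\<eta> * (norm (g k))\<^sup>2))"
      using desc[of k] alpha[of k] assms by (intro mult_left_mono) auto
    also have "\<dots> \<le> - (c * (norm (g k))\<^sup>2)"
      using mult_right_mono[OF step[of k], of "\<delta> * \<eta> * (norm (g k))\<^sup>2"] assms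
      by (simp add: c_def algebra_simps)
    finally have Fdec: "F (x (Suc k)) \<le> F (x k) + \<epsilon> k - c * (norm (g k))\<^sup>2"
      using decrease[of k] inexact_env_bounds(1)[of pa "\<epsilon> (Suc k)" "x (Suc k)"]
        inexact_env_bounds(2)[of pa "\<epsilon> k" "x k"] eps[of k] eps[of "Suc k"] \<open>inexact_prox f lam pa\<close>
      by (simp add: F)
    \<comment> \<open>Expanding this square shows \<open>\<parallel>G\<parallel>\<^sup>2 / 2 \<le> \<parallel>g\<parallel>\<^sup>2 + \<parallel>g - G\<parallel>\<^sup>2\<close>, which transfers the
      Polyak--Lojasiewicz inequality to the inexact gradient.\<close>
    have "0 \<le> (norm (2 *\<^sub>R g k - G (x k)))\<^sup>2" by simp
    also have "\<dots> = 2 * (norm (g k))\<^sup>2 + 2 * (norm (g k - G (x k)))\<^sup>2 - (norm (G (x k)))\<^sup>2"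
      unfolding power2_norm_eq_inner by (simp add: inner_diff inner_commute)
    finally have "\<nu> * (F (x k) - F z) - 2 * \<epsilon> k / lam \<le> (norm (g k))\<^sup>2"
      using err[of k] Polyak_Lojasiewicz[of "x k" z] by (simp add: F nu)
    hence "c * (\<nu> * (F (x k) - F z) - 2 * \<epsilon> k / lam) \<le> c * (norm (g k))\<^sup>2"
      using c by (intro mult_left_mono) auto
    with Fdec have "F (x (Suc k)) - F z
        \<le> (1 - c * \<nu>) * (F (x k) - F z) + (1 + 2 * c / lam) * \<epsilon> k"
      by (simp add: algebra_simps)
    also have "1 - c * \<nu> = \<rho>" using assms by (simp add: c_def)
    also have "(1 + 2 * c / lam) * \<epsilon> k \<le> (1 + 2 * c / lam) * (\<epsilon> 0 * q ^ k)"
      using c assms by (intro mult_left_mono) auto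
    finally show ?thesis by (simp add: C mult.assoc)
  qed
  show ?thesis
  proof (intro conjI allI impI)
    show "\<exists>!z. is_arg_min F (\<lambda>_. True) z"
      unfolding F by (rule moreau_env_minimizer_unique)
  next
    fix z assume z: "is_arg_min F (\<lambda>_. True) z"
    define K where "K = (F (x 0) - F z) + C / (\<rho> - q)"
    have gap: "F (x k) - F z \<le> K * \<rho> ^ k" for k
      unfolding K_def
      by (rule perturbed_linear_recursion[of "\<lambda>k. F (x k) - F z"])
        (use contraction C0 assms in auto)
    have iterate: "norm (x k - z) \<le> sqrt (2 * K / \<nu>) * \<rho> powr (real k / 2)" for k
    proof -
      have "\<nu> / 2 * (norm (x k - z))\<^sup>2 \<le> K * \<rho> ^ k"
        using quadratic_growth[of z "x k"] z gap[of k] by (simp add: F nu)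
      hence "(norm (x k - z))\<^sup>2 \<le> 2 * K / \<nu> * \<rho> ^ k"
        using nu_pos by (simp add: nu field_simps)
      hence "norm (x k - z) \<le> sqrt (2 * K / \<nu> * \<rho> ^ k)" by (rule real_le_rsqrt)
      also have "sqrt (2 * K / \<nu> * \<rho> ^ k) = sqrt (2 * K / \<nu>) * \<rho> powr (real k / 2)"
        using \<open>0 < \<rho>\<close>
        unfolding real_sqrt_mult by (simp add: powr_powr flip: powr_realpow powr_half_sqrt)
      finally show ?thesis .
    qed
    have "R_linearly_convergent x z"
    proof (rule R_linearly_convergentI)
      show "0 < sqrt \<rho>" "sqrt \<rho> < 1" using \<open>0 < \<rho>\<close> \<open>\<rho> < 1\<close> by auto
      show "dist (x k) z \<le> sqrt (2 * K / \<nu>) * sqrt \<rho> ^ k" for k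
        using iterate[of k] \<open>0 < \<rho>\<close>
        by (simp add: dist_norm powr_powr flip: powr_realpow powr_half_sqrt)
    qed
    with gap iterate show "let Fstar = F z;
           C = (1 + 2 * \<delta> * m * \<eta> / lam) * \<epsilon> 0;
           K = (F (x 0) - Fstar) + C / (\<rho> - q)
       in (\<forall>k. F (x k) - Fstar \<le> K * \<rho> ^ k \<and>
               norm (x k - z) \<le> sqrt (2 * K / \<nu>) * \<rho> powr (real k / 2)) \<and>
          R_linearly_convergent x z"
      by (simp add: Let_def K_def C_def)
  qed
qed

end
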